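(* Let $A \in \mathbb{R}^{m\times n}$ with $m \ge n$ have exact singular triplets $(\sigma_i, u_i, v_i)$, $i = 1,\dots,n$. Let $L, M, N, \ell$ be positive integers with $M \le N$ and $LM < n$, let $V_{\rm in} \in \mathbb{R}^{n\times L}$, and let $(z_j,\omega_j)$, $j=1,\dots,N$, be quadrature points and weights (with no $z_j$ equal to $0$ or to an eigenvalue of $A^{\rm T}A$) satisfying $$\sum_{j=1}^N \omega_j z_j^k = 0 \ \text{ for } k = 0,1,\dots,N-2, \qquad \sum_{j=1}^N \omega_j z_j^{-1} \ne 0 .$$ Let $f(\sigma) := \sum_{j=1}^N \frac{\omega_j}{z_j - \sigma^2}$, and assume the singular triplets are ordered so that $|f(\sigma_i)| \ge |f(\sigma_{i+1})|$ for $i=1,\dots,n-1$. Let $\widehat{S}^{(\ell)}$ be the matrix obtained from $V_{\rm in}$ by $\ell$ quadrature iterations as defined in the context, and let $$K := [V_{\rm in}, (A^{\rm T}A)V_{\rm in}, \dots, (A^{\rm T}A)^{M-1}V_{\rm in}] .$$ Let $\mathcal{P}_U^{(\ell)}$ and $\mathcal{P}_V^{(\ell)}$ be the orthogonal projectors onto $\mathcal{R}(A\widehat{S}^{(\ell)})$ and $\mathcal{R}(\widehat{S}^{(\ell)})$, respectively, and let $\mathcal{P}_{LM}$ be the spectral projector of $A^{\rm T}A$ onto the invariant subspace $\mathrm{span}\{v_1,\dots,v_{LM}\}$. Assume that the matrix $\mathcal{P}_{LM}K$ has full rank (i.e. rank $LM$). Then for each $i = 1,\dots,LM$ there exists a unique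 vector $s_i \in \mathcal{R}(K)$ such that $\mathcal{P}_{LM}s_i = v_i$. Moreover, with $\alpha_i := \max_{j \ge LM+1} \sigma_j/\sigma_i$ and $\beta_i := \|v_i - s_i\|_2$, $$\|(I - \mathcal{P}_U^{(\ell)})u_i\|_2 \le \alpha_i\beta_i \left|\frac{f(\sigma_{LM+1})}{f(\sigma_i)}\right|^\ell, \qquad i=1,\dots,LM,$$ and $$\|(I - \mathcal{P}_V^{(\ell)})v_i\|_2 \le \beta_i \left|\frac{f(\sigma_{LM+1})}{f(\sigma_i)}\right|^\ell, \qquad i=1,\dots,LM,$$ where each bound is asserted for those $i$ for which its right-hand side is defined (i.e. $f(\sigma_i) \ne 0$, and for the first bound also $\sigma_i \neq 0$).
   Context: The singular value decomposition is $A = U\Sigma V^{\rm T} = \sum_{i=1}^n \sigma_i u_i v_i^{\rm T}$ with $\sigma_i \ge 0$, $\Sigma = \mathrm{diag}(\sigma_1,\dots,\sigma_n)$, and $U=[u_1,\dots,u_n] \in \mathbb{R}^{m\times n}$, $V = [v_1,\dots,v_n]\in\mathbb{R}^{n\times n}$ having orthonormal columns; the indexing of the triplets follows the ordering by $|f(\sigma_i)|$, not the size of $\sigma_i$. The projector $\mathcal{P}_{LM}$ is $\sum_{i=1}^{LM} v_i v_i^{\rm T}$. The matrix $\widehat{S}^{(\ell)}$ is defined as follows. Put $\widehat{S}_0^{(0)} := V_{\rm in}$ and $$\widehat{S}_0^{(\nu)} := \sum_{j=1}^N \omega_j (z_jI - A^{\rm T}A)^{-1}\widehat{S}_0^{(\nu-1)},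 \qquad \nu = 1,\dots,\ell-1,$$ then $$\widehat{S}_k^{(\ell)} := \sum_{j=1}^N \omega_j z_j^k (z_jI - A^{\rm T}A)^{-1}\widehat{S}_0^{(\ell-1)}, \quad k = 0,\dots,M-1, \qquad \widehat{S}^{(\ell)} := [\widehat{S}_0^{(\ell)}, \widehat{S}_1^{(\ell)}, \dots, \widehat{S}_{M-1}^{(\ell)}].$$ $\mathcal{R}(X)$ denotes the range (column space) of a matrix $X$. The points $z_j$ and weights $\omega_j$ are complex numbers; if the resulting matrices are complex, ranges are taken over $\mathbb{C}$ and orthogonality is with respect to the standard Hermitian inner product. $\|\cdot\|_2$ is the Euclidean norm. *)

theory Defs
  imports
    "HOL-Analysis.L2_Norm"
    "Jordan_Normal_Form.Gauss_Jordan_Elimination"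
    "Jordan_Normal_Form.Schur_Decomposition"
    "Jordan_Normal_Form.DL_Rank"
begin

text \<open>All indices start at 0, as for matrix entries and columns: the \<open>i\<close>-th singular triplet,
  \<open>i = 1..n\<close>, is \<open>(\<sigma> i, col U i, col V i)\<close> with \<open>i < n\<close>, and the quadrature pairs are
  \<open>(z j, \<omega> j)\<close> with \<open>j < N\<close>. In particular \<open>\<sigma> (L * M)\<close> is the singular value number \<open>LM + 1\<close>.\<close>

abbreviation range_mat :: "'a :: field mat \<Rightarrow> 'a vec set" where
  "range_mat X \<equiv> vec_space.col_space (dim_row X) X"

abbreviation rank_mat :: "'a :: field mat \<Rightarrow> nat" where
  "rank_mat X \<equiv> vec_space.rank (dim_row X) X"

abbreviation complex_mat :: "real mat \<Rightarrow> complex mat" where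
  "complex_mat X \<equiv> map_mat complex_of_real X"

abbreviation complex_vec :: "real vec \<Rightarrow> complex vec" where
  "complex_vec x \<equiv> map_vec complex_of_real x"

definition norm2 :: "'a :: real_normed_field vec \<Rightarrow> real" where
  "norm2 x = L2_set (\<lambda>i. norm (x $ i)) {..<dim_vec x}"

text \<open>Thin singular value decomposition; no ordering of the singular values is imposed.\<close>

definition is_svd :: "nat \<Rightarrow> nat \<Rightarrow> real mat \<Rightarrow> real mat \<Rightarrow> (nat \<Rightarrow> real) \<Rightarrow> real mat \<Rightarrow> bool" where
  "is_svd m n A U \<sigma> V \<longleftrightarrow>
     A \<in> carrier_mat m n \<and> U \<in> carrier_mat m n \<and> V \<in> carrier_mat n n \<and>
     (\<forall>i<n. \<sigma> i \<ge> 0) \<and>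
     U\<^sup>T * U = 1\<^sub>m n \<and> V\<^sup>T * V = 1\<^sub>m n \<and>
     A = U * mat_diag n \<sigma> * V\<^sup>T"

text \<open>The sum of \<open>v v\<^sup>T\<close> over the first \<open>k\<close> columns \<open>v\<close> of \<open>V\<close>.\<close>

definition spectral_projector :: "nat \<Rightarrow> real mat \<Rightarrow> nat \<Rightarrow> real mat" where
  "spectral_projector n V k = mat n n (\<lambda>(a, b). \<Sum>i<k. col V i $ a * col V i $ b)"

definition is_orth_projector :: "nat \<Rightarrow> complex mat \<Rightarrow> complex vec set \<Rightarrow> bool" where
  "is_orth_projector d P W \<longleftrightarrow>
     P \<in> carrier_mat d d \<and> P * P = P \<and> mat_adjoint P = P \<and> range_mat P = W"

text \<open>The block row \<open>[X 0, X 1, \<dots>, X (M - 1)]\<close> of \<open>n \<times> L\<close> blocks.\<close>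

definition block_row :: "nat \<Rightarrow> nat \<Rightarrow> nat \<Rightarrow> (nat \<Rightarrow> 'a mat) \<Rightarrow> 'a mat" where
  "block_row n L M X = mat n (L * M) (\<lambda>(i, c). X (c div L) $$ (i, c mod L))"

definition filter_fun :: "nat \<Rightarrow> (nat \<Rightarrow> complex) \<Rightarrow> (nat \<Rightarrow> complex) \<Rightarrow> real \<Rightarrow> complex" where
  "filter_fun N z \<omega> \<sigma> = (\<Sum>j<N. \<omega> j / (z j - complex_of_real (\<sigma>\<^sup>2)))"

text \<open>\<open>B\<close> is an \<open>n \<times> n\<close> matrix and no \<open>z j\<close> may be one of its eigenvalues; otherwise
  \<open>the (mat_inverse _)\<close> is unspecified.\<close>

definition resolvent :: "nat \<Rightarrow> complex mat \<Rightarrow> complex \<Rightarrow> complex mat" where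
  "resolvent n B w = the (mat_inverse (w \<cdot>\<^sub>m 1\<^sub>m n - B))"

text \<open>The matrix \<open>\<Sum>j<N. \<omega> j * z j ^ k * (z j I - B)\<inverse> S\<close>, with the sum written entrywise because
  matrices of varying dimension do not form an additive monoid type.\<close>

definition quad_moment ::
  "nat \<Rightarrow> complex mat \<Rightarrow> nat \<Rightarrow> (nat \<Rightarrow> complex) \<Rightarrow> (nat \<Rightarrow> complex) \<Rightarrow> nat \<Rightarrow> complex mat \<Rightarrow> complex mat"
  where
  "quad_moment n B N z \<omega> k S =
     mat n (dim_col S) (\<lambda>(a, b). \<Sum>j<N. \<omega> j * z j ^ k * (resolvent n B (z j) * S) $$ (a, b))"

definition S0_iter ::
  "nat \<Rightarrow> complex mat \<Rightarrow> nat \<Rightarrow> (nat \<Rightarrow> complex) \<Rightarrow> (nat \<Rightarrow> complex) \<Rightarrow> complex mat \<Rightarrow> nat \<Rightarrow> complex mat"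
  where
  "S0_iter n B N z \<omega> V\<^sub>0 \<nu> = (quad_moment n B N z \<omega> 0 ^^ \<nu>) V\<^sub>0"

text \<open>The result of \<open>l \<ge> 1\<close> quadrature iterations; only the last one uses the moments \<open>k > 0\<close>.\<close>

definition S_hat ::
  "nat \<Rightarrow> nat \<Rightarrow> nat \<Rightarrow> real mat \<Rightarrow> nat \<Rightarrow> (nat \<Rightarrow> complex) \<Rightarrow> (nat \<Rightarrow> complex) \<Rightarrow> real mat \<Rightarrow> nat
   \<Rightarrow> complex mat" where
  "S_hat n L M A N z \<omega> Vin l =
     (let B = complex_mat (A\<^sup>T * A)
      in block_row n L M
           (\<lambda>k. quad_moment n B N z \<omega> k (S0_iter n B N z \<omega> (complex_mat Vin) (l - 1))))"

definition krylov_mat :: "nat \<Rightarrow> nat \<Rightarrow> nat \<Rightarrow> real mat \<Rightarrow> real mat \<Rightarrow> real mat" where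
  "krylov_mat n L M A Vin = block_row n L M (\<lambda>k. (A\<^sup>T * A) ^\<^sub>m k * Vin)"

end

theory Submission
  imports Defs
begin

text \<open>
  Write \<open>B = A\<^sup>T A = V diag(\<sigma>\<^sup>2) V\<^sup>T\<close>. Every matrix that the iteration applies is a function of \<open>B\<close>,
  that is, of the form \<open>V diag(g) V\<^sup>T\<close>, and such matrices multiply as their diagonals do. The moment
  conditions on the quadrature rule turn \<open>\<Sum>j<N. \<omega> j * z j ^ k / (z j - x)\<close> into
  \<open>x ^ k * (\<Sum>j<N. \<omega> j / (z j - x))\<close> for \<open>k < N\<close> (\<open>quad_filter_moment\<close>), so that the \<open>k\<close>-th block of the
  last iterate is \<open>f(B)\<^sup>l B\<^sup>k Vin\<close>, and \<open>S = f(B)\<^sup>l K\<close> as a whole (\<open>S_hat_filtered_krylov\<close>). The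
  quadrature iteration is therefore a filter applied to the Krylov matrix \<open>K\<close>.

  Let \<open>k = L * M\<close> and let \<open>Q\<close> consist of the first \<open>k\<close> columns of \<open>V\<close>, so that the spectral projector
  is \<open>Q Q\<^sup>T\<close>. If \<open>Q Q\<^sup>T K\<close> has rank \<open>k\<close>, then the square matrix \<open>Q\<^sup>T K\<close> is invertible, and
  \<open>s = K (Q\<^sup>T K)\<^sup>-\<^sup>1 e\<^sub>i\<close> is the only vector of the range of \<open>K\<close> that the projector maps to \<open>v\<^sub>i\<close>
  (\<open>ex1_range_projecting_to\<close>).

  For the bounds, \<open>w = v\<^sub>i - s\<close> is orthogonal to \<open>v\<^sub>j\<close> for all \<open>j < k\<close>. Put \<open>h = f\<^sup>l / f(\<sigma>\<^sub>i)\<^sup>l\<close>. Then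
  \<open>y = h(B) s\<close> lies in the range of \<open>S\<close>, and since \<open>h(B) v\<^sub>i = v\<^sub>i\<close>, the error is
  \<open>v\<^sub>i - y = h(B) w\<close>. Only the components of \<open>w\<close> along \<open>v\<^sub>j\<close> with \<open>j \<ge> k\<close> survive, where \<open>h\<close> is at
  most \<open>\<bar>f(\<sigma>\<^sub>k) / f(\<sigma>\<^sub>i)\<bar>\<^sup>l\<close> in modulus. On the left, \<open>A v\<^sub>i = \<sigma>\<^sub>i u\<^sub>i\<close> gives
  \<open>u\<^sub>i - A y / \<sigma>\<^sub>i = U diag(\<sigma> h / \<sigma>\<^sub>i) V\<^sup>T w\<close>, which costs the additional factor
  \<open>max \<sigma>\<^sub>j / \<sigma>\<^sub>i\<close>. An orthogonal projector gives the best approximation from its range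
  (\<open>orth_projector_best_approx\<close>), so each projection error is at most the error of this
  particular approximation (\<open>filtered_krylov_error_bounds\<close>).
\<close>

section \<open>Euclidean norm, adjoints and orthogonal projectors\<close>

lemma norm2_nonneg: "norm2 x \<ge> 0"
  by (simp add: norm2_def L2_set_nonneg)

lemma norm2_sq: "(norm2 x)\<^sup>2 = (\<Sum>i<dim_vec x. (norm (x $ i))\<^sup>2)"
  by (simp add: norm2_def L2_set_def sum_nonneg)

lemma norm2_sq_cscalar: "x \<bullet>c x = complex_of_real ((norm2 x)\<^sup>2)"
  unfolding norm2_sq scalar_prod_def
  by (simp add: atLeast0LessThan complex_norm_square del: of_real_power)

lemma norm2_complex_vec: "norm2 (complex_vec x) = norm2 x"
  by (simp add: norm2_def L2_set_def)

lemma cscalar_mat_adjoint: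
  fixes Q :: "complex mat"
  assumes Q: "Q \<in> carrier_mat a b" and x: "x \<in> carrier_vec b" and y: "y \<in> carrier_vec a"
  shows "(Q *\<^sub>v x) \<bullet>c y = x \<bullet>c (mat_adjoint Q *\<^sub>v y)"
proof -
  have "(Q *\<^sub>v x) \<bullet>c y = (\<Sum>r<a. \<Sum>c<b. Q $$ (r, c) * x $ c * cnj (y $ r))"
    using Q x y by (simp add: scalar_prod_def atLeast0LessThan sum_distrib_right)
  also have "\<dots> = (\<Sum>c<b. \<Sum>r<a. Q $$ (r, c) * x $ c * cnj (y $ r))"
    by (rule sum.swap)
  also have "\<dots> = x \<bullet>c (mat_adjoint Q *\<^sub>v y)"
    using Q x y
    by (simp add: scalar_prod_def atLeast0LessThan sum_distrib_left mat_adjoint_def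
        mat_of_rows_def ac_simps)
  finally show ?thesis .
qed

lemma mat_adjoint_complex_mat:
  "mat_adjoint (complex_mat Q) = (complex_mat Q)\<^sup>T"
  by (rule eq_matI) (auto simp: mat_adjoint_def mat_of_rows_def)

lemma norm2_isometry:
  fixes Q :: "complex mat"
  assumes Q: "Q \<in> carrier_mat a b" and iso: "mat_adjoint Q * Q = 1\<^sub>m b"
    and x: "x \<in> carrier_vec b"
  shows "norm2 (Q *\<^sub>v x) = norm2 x"
proof -
  have adj: "mat_adjoint Q \<in> carrier_mat b a"
    using Q by (auto simp: mat_adjoint_def)
  have "complex_of_real ((norm2 (Q *\<^sub>v x))\<^sup>2) = x \<bullet>c (mat_adjoint Q *\<^sub>v (Q *\<^sub>v x))"
    unfolding norm2_sq_cscalar[symmetric] using Q x by (simp add: cscalar_mat_adjoint)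
  also have "mat_adjoint Q *\<^sub>v (Q *\<^sub>v x) = x"
    using assoc_mult_mat_vec[OF adj Q x] iso x by simp
  finally have "(norm2 (Q *\<^sub>v x))\<^sup>2 = (norm2 x)\<^sup>2"
    unfolding norm2_sq_cscalar of_real_eq_iff .
  then show ?thesis
    by (rule power2_eq_imp_eq) (rule norm2_nonneg)+
qed

lemma norm2_mono:
  fixes x y :: "complex vec"
  assumes "dim_vec x = dim_vec y" and "C \<ge> 0"
    and "\<And>i. i < dim_vec y \<Longrightarrow> norm (x $ i) \<le> C * norm (y $ i)"
  shows "norm2 x \<le> C * norm2 y"
proof -
  have "norm2 x \<le> L2_set (\<lambda>i. C * norm (y $ i)) {..<dim_vec y}"
    unfolding norm2_def assms(1) by (rule L2_set_mono) (use assms in auto)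
  then show ?thesis
    using assms(2) by (simp add: norm2_def L2_set_right_distrib)
qed

lemma range_mat_eq:
  fixes X :: "'a :: field mat"
  assumes "X \<in> carrier_mat a b"
  shows "range_mat X = {X *\<^sub>v x |x. x \<in> carrier_vec b}"
  using vec_space.col_space_eq[OF assms] assms by auto

text \<open>Since \<open>P\<close> fixes \<open>y\<close>, the residual of \<open>x\<close> is the residual of the error \<open>x - y\<close>, and by Pythagoras
  the residual of a vector is no longer than the vector itself.\<close>

lemma orth_projector_best_approx:
  assumes P: "is_orth_projector d P W" and x: "x \<in> carrier_vec d" and y: "y \<in> W"
  shows "norm2 ((1\<^sub>m d - P) *\<^sub>v x) \<le> norm2 (x - y)"
proof -
  have Pc: "P \<in> carrier_mat d d" and PP: "P * P = P" and adj: "mat_adjoint P = P"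
    and W: "W = range_mat P"
    using P by (auto simp: is_orth_projector_def)
  have idem: "P *\<^sub>v (P *\<^sub>v u) = P *\<^sub>v u" if "u \<in> carrier_vec d" for u
    using assoc_mult_mat_vec[OF Pc Pc that] PP by simp
  obtain c where c: "c \<in> carrier_vec d" "y = P *\<^sub>v c"
    using y unfolding W range_mat_eq[OF Pc] by blast
  have yc: "y \<in> carrier_vec d"
    using Pc c by simp
  have Py: "P *\<^sub>v y = y"
    using idem c by simp
  define e where "e = x - y"
  have e: "e \<in> carrier_vec d"
    using x yc by (simp add: e_def)
  define p where "p = P *\<^sub>v e"
  have p: "p \<in> carrier_vec d"
    using Pc e by (simp add: p_def)
  have "(1\<^sub>m d - P) *\<^sub>v x = x - P *\<^sub>v x"
    using Pc x by (simp add: minus_mult_distrib_mat_vec[where nr = d and nc = d])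
  also have "\<dots> = e - p"
    using Pc x yc unfolding p_def e_def
    by (simp add: mult_minus_distrib_mat_vec[OF Pc] Py) (rule eq_vecI; simp)
  finally have res: "(1\<^sub>m d - P) *\<^sub>v x = e - p" .
  have pe: "p \<bullet>c e = e \<bullet>c p"
    using cscalar_mat_adjoint[OF Pc e e] by (simp add: adj p_def)
  have pp: "p \<bullet>c p = e \<bullet>c p"
    using cscalar_mat_adjoint[OF Pc e p] idem[OF e] by (simp add: adj p_def)
  \<comment> \<open>Both mixed products equal \<open>p \<bullet>c p\<close>, because \<open>P\<close> is self-adjoint and idempotent.\<close>
  have "(e - p) \<bullet>c (e - p) = e \<bullet>c e - e \<bullet>c p - (p \<bullet>c e - p \<bullet>c p)"
    using e p by (simp add: scalar_prod_def algebra_simps sum_subtractf sum.distrib)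
  also have "\<dots> = e \<bullet>c e - p \<bullet>c p"
    using pe pp by simp
  finally have "(norm2 (e - p))\<^sup>2 = (norm2 e)\<^sup>2 - (norm2 p)\<^sup>2"
    unfolding norm2_sq_cscalar of_real_diff[symmetric] of_real_eq_iff .
  then have "(norm2 (e - p))\<^sup>2 \<le> (norm2 e)\<^sup>2"
    by simp
  then have "norm2 (e - p) \<le> norm2 e"
    by (rule power2_le_imp_le) (rule norm2_nonneg)
  then show ?thesis
    by (simp add: res e_def)
qed

section \<open>Functions of a symmetric matrix\<close>

text \<open>For orthogonal \<open>V\<close> this is the function \<open>g\<close> of a symmetric matrix with eigenvectors \<open>col V i\<close>;
  \<open>g\<close> is indexed by the position of the eigenvalue, so equal eigenvalues need no separate treatment.\<close>

definition spectral_fun :: "nat \<Rightarrow> real mat \<Rightarrow> (nat \<Rightarrow> complex) \<Rightarrow> complex mat" where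
  "spectral_fun n V g = complex_mat V * mat_diag n g * (complex_mat V)\<^sup>T"

lemma spectral_fun_carrier [simp]:
  "V \<in> carrier_mat n n \<Longrightarrow> spectral_fun n V g \<in> carrier_mat n n"
  by (auto simp: spectral_fun_def)

lemma spectral_fun_index:
  assumes "V \<in> carrier_mat n n" "a < n" "b < n"
  shows "spectral_fun n V g $$ (a, b)
    = (\<Sum>i<n. g i * (complex_of_real (V $$ (a, i)) * complex_of_real (V $$ (b, i))))"
  using assms unfolding spectral_fun_def
  by (subst mat_diag_mult_right[of _ n n])
    (auto simp: scalar_prod_def atLeast0LessThan ac_simps intro!: sum.cong)

lemma spectral_fun_cong:
  "(\<And>i. i < n \<Longrightarrow> g i = h i) \<Longrightarrow> spectral_fun n V g = spectral_fun n V h"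
  unfolding spectral_fun_def mat_diag_def
  by (rule arg_cong2[where f = "(*)"]) (auto intro!: arg_cong2[where f = "(*)"])

lemma orthogonal_mat_complex:
  assumes "Q \<in> carrier_mat a b" "Q\<^sup>T * Q = 1\<^sub>m b"
  shows "(complex_mat Q)\<^sup>T * complex_mat Q = 1\<^sub>m b"
proof -
  have "complex_mat (Q\<^sup>T * Q) = (complex_mat Q)\<^sup>T * complex_mat Q"
    using assms(1) by (subst of_real_hom.mat_hom_mult[of _ b a _ b]) (auto simp: map_mat_transpose)
  then show ?thesis
    using assms(2) by (simp add: of_real_hom.mat_hom_one)
qed

lemma norm2_orthogonal_mat:
  assumes "Q \<in> carrier_mat a b" "Q\<^sup>T * Q = 1\<^sub>m b" "x \<in> carrier_vec b"
  shows "norm2 (complex_mat Q *\<^sub>v x) = norm2 x"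
  using assms orthogonal_mat_complex[OF assms(1,2)]
  by (intro norm2_isometry[of _ a b]) (auto simp: mat_adjoint_complex_mat)

lemma orthogonal_mat_right_inverse:
  fixes V :: "'a :: field mat"
  assumes "V \<in> carrier_mat n n" "V\<^sup>T * V = 1\<^sub>m n"
  shows "V * V\<^sup>T = 1\<^sub>m n"
  using assms mat_mult_left_right_inverse[of "V\<^sup>T" n V] by simp

text \<open>The inner factors \<open>V\<^sup>T V\<close> cancel. The left factor is an arbitrary \<open>Q\<close> so that the lemma covers both
  products of two functions of the same matrix and the product with the SVD of \<open>A\<close>.\<close>

lemma mult_spectral_fun:
  assumes Q: "Q \<in> carrier_mat m n" and V: "V \<in> carrier_mat n n" and VV: "V\<^sup>T * V = 1\<^sub>m n"
  shows "Q * mat_diag n g * (complex_mat V)\<^sup>T * spectral_fun n V h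
    = Q * mat_diag n (\<lambda>i. g i * h i) * (complex_mat V)\<^sup>T"
proof -
  let ?W = "complex_mat V"
  have W: "?W \<in> carrier_mat n n" "?W\<^sup>T \<in> carrier_mat n n" and WW: "?W\<^sup>T * ?W = 1\<^sub>m n"
    using V orthogonal_mat_complex[OF V VV] by auto
  have "Q * mat_diag n g * ?W\<^sup>T * spectral_fun n V h
      = Q * mat_diag n g * (?W\<^sup>T * ?W) * mat_diag n h * ?W\<^sup>T"
    unfolding spectral_fun_def using Q W
    by (simp add: assoc_mult_mat[of _ m n _ n _ n] assoc_mult_mat[of _ n n _ n _ n]
        mult_carrier_mat[where n = n])
  also have "\<dots> = Q * (mat_diag n g * mat_diag n h) * ?W\<^sup>T"
    unfolding WW using Q W
    by (simp add: assoc_mult_mat[of _ m n _ n _ n] mult_carrier_mat[where n = n]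
        right_mult_one_mat[where nr = m and nc = n] del: mat_diag_diag)
  finally show ?thesis by simp
qed

lemma spectral_fun_mult:
  assumes V: "V \<in> carrier_mat n n" and VV: "V\<^sup>T * V = 1\<^sub>m n"
  shows "spectral_fun n V g * spectral_fun n V h = spectral_fun n V (\<lambda>i. g i * h i)"
  using mult_spectral_fun[of "complex_mat V" n n V g h] V VV by (simp add: spectral_fun_def)

lemma spectral_fun_one:
  assumes V: "V \<in> carrier_mat n n" and VV: "V\<^sup>T * V = 1\<^sub>m n"
  shows "spectral_fun n V (\<lambda>_. 1) = 1\<^sub>m n"
  using V orthogonal_mat_right_inverse[of "complex_mat V" n] orthogonal_mat_complex[OF V VV]
  by (simp add: spectral_fun_def)

lemma spectral_fun_pow:
  assumes V: "V \<in> carrier_mat n n" and VV: "V\<^sup>T * V = 1\<^sub>m n"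
  shows "spectral_fun n V g ^\<^sub>m k = spectral_fun n V (\<lambda>i. g i ^ k)"
proof (induction k)
  case 0
  then show ?case
    using V spectral_fun_one[OF V VV] spectral_fun_carrier[OF V, of g]
    by (metis (no_types, lifting) carrier_matD(1) pow_mat.simps(1) power_0 spectral_fun_cong)
next
  case (Suc k)
  then show ?case
    using spectral_fun_mult[OF V VV] by (simp add: mult.commute)
qed

lemma spectral_fun_eigenvector:
  assumes V: "V \<in> carrier_mat n n" and VV: "V\<^sup>T * V = 1\<^sub>m n" and i: "i < n"
  shows "spectral_fun n V g *\<^sub>v complex_vec (col V i) = g i \<cdot>\<^sub>v complex_vec (col V i)"
proof -
  let ?W = "complex_mat V"
  have W: "?W \<in> carrier_mat n n" "?W\<^sup>T \<in> carrier_mat n n" and WW: "?W\<^sup>T * ?W = 1\<^sub>m n"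
    using V orthogonal_mat_complex[OF V VV] by auto
  have v: "complex_vec (col V i) = col ?W i"
    using V i by auto
  have "spectral_fun n V g * ?W = ?W * mat_diag n g * (?W\<^sup>T * ?W)"
    unfolding spectral_fun_def using W by (simp add: assoc_mult_mat[of _ n n])
  also have "\<dots> = mat n n (\<lambda>(a, j). ?W $$ (a, j) * g j)"
    unfolding WW using W mat_diag_mult_right[OF W(1), of g] by simp
  finally have "col (spectral_fun n V g * ?W) i = g i \<cdot>\<^sub>v col ?W i"
    using V i by (auto intro!: eq_vecI)
  then show ?thesis
    unfolding v using V i by (subst col_mult2[symmetric, of _ n n _ n]) auto
qed

text \<open>This is what turns the hypothesis that no quadrature point is an eigenvalue into
  \<open>z j \<noteq> g i\<close>, which makes all the fractions below meaningful.\<close>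

lemma spectral_fun_eigenvalue:
  assumes V: "V \<in> carrier_mat n n" and VV: "V\<^sup>T * V = 1\<^sub>m n" and i: "i < n"
  shows "eigenvalue (spectral_fun n V g) (g i)"
proof -
  let ?v = "complex_vec (col V i)"
  have nz: "?v \<noteq> 0\<^sub>v n"
  proof
    assume *: "?v = 0\<^sub>v n"
    have "col V i $ a = 0" if "a < n" for a
      using arg_cong[OF *, of "\<lambda>x. x $ a"] that V i by simp
    then have "col V i = 0\<^sub>v n"
      using V i by (intro eq_vecI) auto
    then have "(V\<^sup>T * V) $$ (i, i) = 0"
      using V i by simp
    then show False
      using VV i by simp
  qed
  have "?v \<in> carrier_vec n"
    using V i by auto
  then have "eigenvector (spectral_fun n V g) ?v (g i)"
    using spectral_fun_eigenvector[OF V VV i] nz spectral_fun_carrier[OF V, of g]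
    by (auto simp: eigenvector_def)
  then show ?thesis
    by (auto simp: eigenvalue_def)
qed

lemma smult_spectral_fun:
  assumes "V \<in> carrier_mat n n"
  shows "a \<cdot>\<^sub>m spectral_fun n V g = spectral_fun n V (\<lambda>i. a * g i)"
  using assms carrier_matD[OF spectral_fun_carrier[OF assms]]
  by (intro eq_matI) (auto simp: spectral_fun_index sum_distrib_left ac_simps)

text \<open>The right-hand side is a two-sided inverse, so Gauss-Jordan inversion succeeds and returns it.\<close>

lemma resolvent_spectral_fun:
  assumes V: "V \<in> carrier_mat n n" and VV: "V\<^sup>T * V = 1\<^sub>m n"
    and w: "\<And>i. i < n \<Longrightarrow> w \<noteq> g i"
  shows "resolvent n (spectral_fun n V g) w = spectral_fun n V (\<lambda>i. 1 / (w - g i))"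
proof -
  let ?R = "spectral_fun n V (\<lambda>i. 1 / (w - g i))"
  let ?T = "w \<cdot>\<^sub>m 1\<^sub>m n - spectral_fun n V g"
  note car = spectral_fun_carrier[OF V] carrier_matD[OF spectral_fun_carrier[OF V]]
  have "w \<cdot>\<^sub>m 1\<^sub>m n = spectral_fun n V (\<lambda>_. w)"
    using smult_spectral_fun[OF V, of w "\<lambda>_. 1"] spectral_fun_one[OF V VV] by simp
  then have T: "?T = spectral_fun n V (\<lambda>i. w - g i)"
    using V car
    by (intro eq_matI) (auto simp: spectral_fun_index sum_subtractf[symmetric] algebra_simps)
  have Tc: "?T \<in> carrier_mat n n"
    unfolding T using V by simp
  have "spectral_fun n V (\<lambda>i. (w - g i) * (1 / (w - g i))) = spectral_fun n V (\<lambda>_. 1)"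
    "spectral_fun n V (\<lambda>i. 1 / (w - g i) * (w - g i)) = spectral_fun n V (\<lambda>_. 1)"
    using w by (auto intro!: spectral_fun_cong)
  then have inv: "?T * ?R = 1\<^sub>m n" "?R * ?T = 1\<^sub>m n"
    unfolding T spectral_fun_mult[OF V VV] spectral_fun_one[OF V VV] by auto
  have "mat_inverse ?T \<noteq> None"
    using mat_inverse(1)[OF Tc, of "()"] inv car Tc
    by (auto simp: Units_def ring_mat_def intro: bexI[of _ ?R])
  then obtain X where X: "mat_inverse ?T = Some X"
    by auto
  then have X': "X * ?T = 1\<^sub>m n" "X \<in> carrier_mat n n"
    using mat_inverse(2)[OF Tc] by auto
  have "X = X * (?T * ?R)"
    using X' inv by simp
  also have "\<dots> = ?R"
    using assoc_mult_mat[OF X'(2) Tc car(1)] X'(1) car(1) by (metis left_mult_one_mat)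
  finally show ?thesis
    by (simp add: resolvent_def X)
qed

section \<open>Quadrature moments\<close>

text \<open>Induction on \<open>k\<close> by \<open>z\<^sup>k\<^sup>+\<^sup>1 / (z - x) = z\<^sup>k + x * z\<^sup>k / (z - x)\<close>. The polynomial remainder is summed only
  for exponents up to \<open>N - 2\<close>, where the quadrature sum vanishes.\<close>

lemma quad_filter_moment:
  fixes z \<omega> :: "nat \<Rightarrow> complex"
  assumes mom: "\<forall>k. k + 2 \<le> N \<longrightarrow> (\<Sum>j<N. \<omega> j * z j ^ k) = 0"
    and x: "\<And>j. j < N \<Longrightarrow> z j \<noteq> x" and k: "k < N"
  shows "(\<Sum>j<N. \<omega> j * z j ^ k / (z j - x)) = x ^ k * (\<Sum>j<N. \<omega> j / (z j - x))"
  using k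
proof (induction k)
  case (Suc k)
  have "\<omega> j * z j ^ Suc k / (z j - x) = \<omega> j * z j ^ k + x * (\<omega> j * z j ^ k / (z j - x))"
    if "j < N" for j
    using x[OF that] by (simp add: field_simps)
  then have "(\<Sum>j<N. \<omega> j * z j ^ Suc k / (z j - x))
      = (\<Sum>j<N. \<omega> j * z j ^ k) + x * (\<Sum>j<N. \<omega> j * z j ^ k / (z j - x))"
    by (simp add: sum.distrib sum_distrib_left)
  then show ?case
    using mom Suc by simp
qed simp

lemma quad_moment_spectral_fun:
  assumes V: "V \<in> carrier_mat n n" and VV: "V\<^sup>T * V = 1\<^sub>m n"
    and z: "\<And>i j. i < n \<Longrightarrow> j < N \<Longrightarrow> z j \<noteq> g i" and X: "X \<in> carrier_mat n c"
  shows "quad_moment n (spectral_fun n V g) N z \<omega> k X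
    = spectral_fun n V (\<lambda>i. \<Sum>j<N. \<omega> j * z j ^ k / (z j - g i)) * X"
proof (rule eq_matI)
  show "dim_row (quad_moment n (spectral_fun n V g) N z \<omega> k X)
    = dim_row (spectral_fun n V (\<lambda>i. \<Sum>j<N. \<omega> j * z j ^ k / (z j - g i)) * X)"
    using carrier_matD[OF spectral_fun_carrier[OF V]] by (simp add: quad_moment_def)
next
  let ?W = "\<lambda>a b i. complex_of_real (V $$ (a, i)) * complex_of_real (V $$ (b, i))"
  fix a b
  assume "a < dim_row (spectral_fun n V (\<lambda>i. \<Sum>j<N. \<omega> j * z j ^ k / (z j - g i)) * X)"
    and "b < dim_col (spectral_fun n V (\<lambda>i. \<Sum>j<N. \<omega> j * z j ^ k / (z j - g i)) * X)"
  then have a: "a < n" and b: "b < c"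
    using X carrier_matD[OF spectral_fun_carrier[OF V]] by auto
  have entry: "(spectral_fun n V h * X) $$ (a, b)
      = (\<Sum>r<n. \<Sum>i<n. h i * ?W a r i * X $$ (r, b))" for h
    using a b X V carrier_matD[OF spectral_fun_carrier[OF V]]
    by (simp add: scalar_prod_def atLeast0LessThan spectral_fun_index sum_distrib_right)
  have "quad_moment n (spectral_fun n V g) N z \<omega> k X $$ (a, b)
      = (\<Sum>j<N. \<omega> j * z j ^ k * (resolvent n (spectral_fun n V g) (z j) * X) $$ (a, b))"
    using a b X by (simp add: quad_moment_def)
  also have "\<dots> = (\<Sum>j<N. \<Sum>r<n. \<Sum>i<n. \<omega> j * z j ^ k / (z j - g i) * ?W a r i * X $$ (r, b))"
    using z by (intro sum.cong refl)
      (simp add: resolvent_spectral_fun[OF V VV] entry sum_distrib_left ac_simps)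
  also have "\<dots> = (\<Sum>r<n. \<Sum>i<n. \<Sum>j<N. \<omega> j * z j ^ k / (z j - g i) * ?W a r i * X $$ (r, b))"
    by (subst sum.swap, rule sum.cong[OF refl], rule sum.swap)
  also have "\<dots> = (spectral_fun n V (\<lambda>i. \<Sum>j<N. \<omega> j * z j ^ k / (z j - g i)) * X) $$ (a, b)"
    unfolding entry by (simp add: sum_distrib_right)
  finally show "quad_moment n (spectral_fun n V g) N z \<omega> k X $$ (a, b)
    = (spectral_fun n V (\<lambda>i. \<Sum>j<N. \<omega> j * z j ^ k / (z j - g i)) * X) $$ (a, b)" .
qed (simp add: quad_moment_def)

lemma block_row_carrier [simp]: "block_row n L M X \<in> carrier_mat n (L * M)"
  by (simp add: block_row_def)

lemma block_index_bounds:
  assumes "c < L * (M :: nat)"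
  shows "c div L < M" "c mod L < L"
proof -
  have "L > 0"
    using assms by (cases L) auto
  then show "c div L < M" "c mod L < L"
    using assms by (auto simp: less_mult_imp_div_less mult.commute)
qed

lemma mult_block_row:
  fixes P :: "'a :: semiring_0 mat"
  assumes P: "P \<in> carrier_mat n n" and X: "\<And>k. k < M \<Longrightarrow> X k \<in> carrier_mat n L"
  shows "P * block_row n L M X = block_row n L M (\<lambda>k. P * X k)"
proof (rule eq_matI)
  fix a c
  assume "a < dim_row (block_row n L M (\<lambda>k. P * X k))"
    and "c < dim_col (block_row n L M (\<lambda>k. P * X k))"
  then have a: "a < n" and c: "c < L * M"
    by (auto simp: block_row_def)
  show "(P * block_row n L M X) $$ (a, c) = block_row n L M (\<lambda>k. P * X k) $$ (a, c)"
    using a c P X[OF block_index_bounds(1)[OF c]] block_index_bounds[OF c]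
    by (auto simp: block_row_def scalar_prod_def)
qed (use P in \<open>auto simp: block_row_def\<close>)

lemma block_row_cong:
  "(\<And>k. k < M \<Longrightarrow> X k = Y k) \<Longrightarrow> block_row n L M X = block_row n L M Y"
  by (rule eq_matI) (auto simp: block_row_def block_index_bounds)

lemma complex_block_row:
  assumes X: "\<And>k. k < M \<Longrightarrow> X k \<in> carrier_mat n L"
  shows "complex_mat (block_row n L M X) = block_row n L M (\<lambda>k. complex_mat (X k))"
proof (rule eq_matI)
  fix a c
  assume "a < dim_row (block_row n L M (\<lambda>k. complex_mat (X k)))"
    and "c < dim_col (block_row n L M (\<lambda>k. complex_mat (X k)))"
  then have a: "a < n" and c: "c < L * M"
    by (auto simp: block_row_def)
  show "complex_mat (block_row n L M X) $$ (a, c) = block_row n L M (\<lambda>k. complex_mat (X k)) $$ (a, c)"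
    using a c X[OF block_index_bounds(1)[OF c]] block_index_bounds[OF c]
    by (auto simp: block_row_def)
qed (auto simp: block_row_def)

section \<open>The iteration as a filtered Krylov matrix\<close>

lemma svd_gram_spectral_fun:
  assumes svd: "is_svd m n A U \<sigma> V"
  shows "complex_mat (A\<^sup>T * A) = spectral_fun n V (\<lambda>i. complex_of_real ((\<sigma> i)\<^sup>2))"
proof -
  let ?D = "mat_diag n \<sigma>"
  have A: "A = U * ?D * V\<^sup>T" and U: "U \<in> carrier_mat m n" "U\<^sup>T \<in> carrier_mat n m"
    and V: "V \<in> carrier_mat n n" "V\<^sup>T \<in> carrier_mat n n" and UU: "U\<^sup>T * U = 1\<^sub>m n"
    using svd by (auto simp: is_svd_def)
  have D: "?D \<in> carrier_mat n n" "?D\<^sup>T = ?D"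
    by (auto simp: mat_diag_def)
  have "(U * ?D)\<^sup>T = ?D * U\<^sup>T"
    using transpose_mult[OF U(1) D(1)] D(2) by simp
  moreover have "(U * ?D * V\<^sup>T)\<^sup>T = V * (U * ?D)\<^sup>T"
    using transpose_mult[OF mult_carrier_mat[OF U(1) D(1)] V(2)] by (simp only: transpose_transpose)
  ultimately have At: "A\<^sup>T = V * (?D * U\<^sup>T)"
    by (simp only: A)
  have A': "A = U * (?D * V\<^sup>T)"
    unfolding A by (rule assoc_mult_mat[OF U(1) D(1) V(2)])
  have "A\<^sup>T * A = V * (?D * U\<^sup>T) * (U * (?D * V\<^sup>T))"
    unfolding At by (simp only: A')
  also have "\<dots> = V * (?D * ((U\<^sup>T * U) * (?D * V\<^sup>T)))"
    using U V D
    by (simp add: assoc_mult_mat[of V n n _ m _ n] assoc_mult_mat[of ?D n n "U\<^sup>T" m _ n]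
        assoc_mult_mat[of "U\<^sup>T" n m U n _ n] mult_carrier_mat[of _ n m _ n] mult_carrier_mat[of _ n n _ n]
        mult_carrier_mat[of _ n n _ m] mult_carrier_mat[of _ m n _ n])
  also have "\<dots> = V * (?D * (?D * V\<^sup>T))"
    unfolding UU by (simp only: left_mult_one_mat[OF mult_carrier_mat[OF D(1) V(2)]])
  also have "\<dots> = V * mat_diag n (\<lambda>i. (\<sigma> i)\<^sup>2) * V\<^sup>T"
    using V D by (simp add: assoc_mult_mat[of ?D n n ?D n "V\<^sup>T" n, symmetric] power2_eq_square
        assoc_mult_mat[of V n n "mat_diag n (\<lambda>i. \<sigma> i * \<sigma> i)" n "V\<^sup>T" n])
  finally have gram: "A\<^sup>T * A = V * mat_diag n (\<lambda>i. (\<sigma> i)\<^sup>2) * V\<^sup>T" .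
  have diag: "complex_mat (mat_diag n h) = mat_diag n (\<lambda>i. complex_of_real (h i))" for h
    by (rule eq_matI) (auto simp: mat_diag_def)
  show ?thesis
    unfolding gram spectral_fun_def
    using V by (simp add: of_real_hom.mat_hom_mult[of _ n n _ n] mult_carrier_mat[of _ n n _ n]
        diag map_mat_transpose)
qed

lemma S0_iter_spectral_fun:
  assumes V: "V \<in> carrier_mat n n" and VV: "V\<^sup>T * V = 1\<^sub>m n"
    and z: "\<And>i j. i < n \<Longrightarrow> j < N \<Longrightarrow> z j \<noteq> g i" and X: "X \<in> carrier_mat n c"
  shows "S0_iter n (spectral_fun n V g) N z \<omega> X \<nu>
    = spectral_fun n V (\<lambda>i. (\<Sum>j<N. \<omega> j / (z j - g i)) ^ \<nu>) * X"
proof (induction \<nu>)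
  case 0
  then show ?case
    using spectral_fun_one[OF V VV] X by (simp add: S0_iter_def)
next
  case (Suc \<nu>)
  let ?q = "\<lambda>i. \<Sum>j<N. \<omega> j / (z j - g i)"
  let ?T = "spectral_fun n V (\<lambda>i. ?q i ^ \<nu>)"
  have T: "?T * X \<in> carrier_mat n c"
    using spectral_fun_carrier[OF V] X by (rule mult_carrier_mat)
  have "S0_iter n (spectral_fun n V g) N z \<omega> X (Suc \<nu>)
      = quad_moment n (spectral_fun n V g) N z \<omega> 0 (?T * X)"
    using Suc by (simp add: S0_iter_def)
  also have "\<dots> = spectral_fun n V ?q * (?T * X)"
    using quad_moment_spectral_fun[OF V VV z T, where k = 0] by simp
  also have "\<dots> = spectral_fun n V (\<lambda>i. ?q i ^ Suc \<nu>) * X"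
    using assoc_mult_mat[OF spectral_fun_carrier[OF V] spectral_fun_carrier[OF V] X]
    by (simp add: spectral_fun_mult[OF V VV, symmetric])
  finally show ?case .
qed

text \<open>The first \<open>l - 1\<close> steps each contribute one factor \<open>f(B)\<close>; the last contributes another one, together
  with the power \<open>B\<^sup>k\<close> that the \<open>k\<close>-th moment produces. The \<open>k\<close>-th block is thus \<open>f(B)\<^sup>l\<close> times the
  \<open>k\<close>-th block of the Krylov matrix.\<close>

lemma S_hat_filtered_krylov:
  assumes svd: "is_svd m n A U \<sigma> V" and Vin: "Vin \<in> carrier_mat n L"
    and l: "l \<ge> 1" and MN: "M \<le> N"
    and z: "\<forall>j<N. \<not> eigenvalue (complex_mat (A\<^sup>T * A)) (z j)"
    and mom: "\<forall>k. k + 2 \<le> N \<longrightarrow> (\<Sum>j<N. \<omega> j * z j ^ k) = 0"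
  shows "S_hat n L M A N z \<omega> Vin l
    = spectral_fun n V (\<lambda>i. filter_fun N z \<omega> (\<sigma> i) ^ l) * complex_mat (krylov_mat n L M A Vin)"
proof -
  have V: "V \<in> carrier_mat n n" and VV: "V\<^sup>T * V = 1\<^sub>m n" and A: "A \<in> carrier_mat m n"
    using svd by (auto simp: is_svd_def)
  let ?g = "\<lambda>i. complex_of_real ((\<sigma> i)\<^sup>2)"
  let ?f = "\<lambda>i. filter_fun N z \<omega> (\<sigma> i)"
  let ?B = "complex_mat (A\<^sup>T * A)"
  let ?X = "complex_mat Vin"
  have B: "?B = spectral_fun n V ?g"
    using svd_gram_spectral_fun[OF svd] .
  have X: "?X \<in> carrier_mat n L"
    using Vin by simp
  have ne: "z j \<noteq> ?g i" if "i < n" "j < N" for i j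
    using z that spectral_fun_eigenvalue[OF V VV that(1), of ?g] unfolding B by metis
  note sc = spectral_fun_carrier[OF V]
  have block: "quad_moment n ?B N z \<omega> k (S0_iter n ?B N z \<omega> ?X (l - 1))
      = spectral_fun n V (\<lambda>i. ?f i ^ l) * complex_mat ((A\<^sup>T * A) ^\<^sub>m k * Vin)" if k: "k < M" for k
  proof -
    let ?S = "spectral_fun n V (\<lambda>i. ?f i ^ (l - 1))"
    have S: "S0_iter n ?B N z \<omega> ?X (l - 1) = ?S * ?X"
      unfolding B
      using S0_iter_spectral_fun[where z = z and g = ?g and N = N, OF V VV ne X, of \<omega> "l - 1"]
      by (simp add: filter_fun_def del: of_real_power)
    have "quad_moment n ?B N z \<omega> k (?S * ?X)
        = spectral_fun n V (\<lambda>i. \<Sum>j<N. \<omega> j * z j ^ k / (z j - ?g i)) * (?S * ?X)"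
      unfolding B by (rule quad_moment_spectral_fun[OF V VV ne mult_carrier_mat[OF sc X]])
    also have "spectral_fun n V (\<lambda>i. \<Sum>j<N. \<omega> j * z j ^ k / (z j - ?g i))
        = spectral_fun n V (\<lambda>i. ?g i ^ k * ?f i)"
      using k MN ne quad_filter_moment[OF mom] by (intro spectral_fun_cong) (simp add: filter_fun_def)
    also have "\<dots> * (?S * ?X) = spectral_fun n V (\<lambda>i. ?g i ^ k * ?f i * ?f i ^ (l - 1)) * ?X"
      by (simp only: assoc_mult_mat[OF sc sc X, symmetric] spectral_fun_mult[OF V VV])
    also have "spectral_fun n V (\<lambda>i. ?g i ^ k * ?f i * ?f i ^ (l - 1))
        = spectral_fun n V (\<lambda>i. ?f i ^ l * ?g i ^ k)"
      using l by (intro spectral_fun_cong) (cases l; simp)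
    also have "\<dots> * ?X = spectral_fun n V (\<lambda>i. ?f i ^ l) * (?B ^\<^sub>m k * ?X)"
      unfolding B spectral_fun_pow[OF V VV]
      by (simp only: assoc_mult_mat[OF sc sc X, symmetric] spectral_fun_mult[OF V VV])
    also have "?B ^\<^sub>m k * ?X = complex_mat ((A\<^sup>T * A) ^\<^sub>m k * Vin)"
      using A Vin by (subst of_real_hom.mat_hom_mult[of _ n n _ L])
        (auto simp: of_real_hom.mat_hom_pow[of _ n] intro!: pow_carrier_mat)
    finally show ?thesis
      unfolding S .
  qed
  have car: "(A\<^sup>T * A) ^\<^sub>m k * Vin \<in> carrier_mat n L" for k
    using mult_carrier_mat[of "A\<^sup>T" n m A n] A
    by (intro mult_carrier_mat[OF pow_carrier_mat Vin]) auto
  show ?thesis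
    unfolding S_hat_def Let_def krylov_mat_def complex_block_row[OF car]
    using car block by (subst mult_block_row) (auto intro!: block_row_cong sc simp: V)
qed

section \<open>Solvability in the Krylov space\<close>

text \<open>Rank is the dimension of the span of the set of columns, so repeated columns have to be excluded
  before linear independence of that set says anything about the kernel.\<close>

lemma full_col_rank_kernel:
  fixes X :: "'a :: field mat"
  assumes X: "X \<in> carrier_mat a b" and rank: "vec_space.rank a X = b"
    and c: "c \<in> carrier_vec b" and Xc: "X *\<^sub>v c = 0\<^sub>v a"
  shows "c = 0\<^sub>v b"
proof (rule ccontr)
  assume nz: "c \<noteq> 0\<^sub>v b"
  interpret vec_space "TYPE('a)" a .
  have "distinct (cols X)"
  proof (rule ccontr)
    assume "\<not> distinct (cols X)"
    then have less: "card (set (cols X)) < b"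
      using X card_distinct[of "cols X"] card_length[of "cols X"] by fastforce
    obtain S where S: "maximal S (\<lambda>T. T \<subseteq> set (cols X) \<and> lin_indpt T)"
      using maximal_exists[of "\<lambda>T. T \<subseteq> set (cols X) \<and> lin_indpt T" "card (set (cols X))" "{}"]
      by (meson List.finite_set card_mono empty_iff empty_subsetI finite_lin_indpt2 rev_finite_subset)
    then have "card S \<le> card (set (cols X))"
      by (simp add: card_mono maximal_def)
    then show False
      using rank_card_indpt[OF X S] rank less by simp
  qed
  then show False
    using full_rank_lin_indpt[OF X rank] lin_depI[OF X c nz Xc] by blast
qed

lemma mult_mat_zero_vec:
  fixes X :: "'a :: semiring_0 mat"
  assumes "X \<in> carrier_mat a b"
  shows "X *\<^sub>v 0\<^sub>v b = 0\<^sub>v a"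
  using assms by (intro eq_vecI) auto

text \<open>The square matrix \<open>Q\<^sup>T X\<close> has trivial kernel, because \<open>Q (Q\<^sup>T X)\<close> has. Its inverse produces the
  coefficients of the solution, and injectivity of \<open>Q Q\<^sup>T X\<close> makes them unique.\<close>

lemma ex1_range_projecting_to:
  fixes Q X :: "'a :: field mat"
  assumes Q: "Q \<in> carrier_mat n k" and QQ: "Q\<^sup>T * Q = 1\<^sub>m k"
    and X: "X \<in> carrier_mat n k" and rank: "vec_space.rank n (Q * Q\<^sup>T * X) = k"
    and b: "b \<in> carrier_vec k"
  shows "\<exists>!s. s \<in> range_mat X \<and> (Q * Q\<^sup>T) *\<^sub>v s = Q *\<^sub>v b"
proof -
  let ?P = "Q * Q\<^sup>T"
  define G where "G = Q\<^sup>T * X"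
  have Qt: "Q\<^sup>T \<in> carrier_mat k n" and P: "?P \<in> carrier_mat n n" and G: "G \<in> carrier_mat k k"
    and PX: "?P * X \<in> carrier_mat n k"
    using Q X by (auto simp: G_def)
  have PXG: "?P * X = Q * G"
    unfolding G_def using Q Qt X by (simp add: assoc_mult_mat)
  have inj: "c = 0\<^sub>v k" if "c \<in> carrier_vec k" "(?P * X) *\<^sub>v c = 0\<^sub>v n" for c
    using full_col_rank_kernel[OF PX rank] that by blast
  have "det G \<noteq> 0"
  proof
    assume "det G = 0"
    then obtain c where c: "c \<in> carrier_vec k" "c \<noteq> 0\<^sub>v k" "G *\<^sub>v c = 0\<^sub>v k"
      using det_0_iff_vec_prod_zero_field[OF G] by blast
    then have "(?P * X) *\<^sub>v c = 0\<^sub>v n"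
      unfolding PXG using Q G by (simp add: mult_mat_zero_vec[OF Q])
    then show False
      using inj c by blast
  qed
  then obtain H where H: "H \<in> carrier_mat k k" "G * H = 1\<^sub>m k"
    using det_non_zero_imp_unit[OF G] by (auto simp: Units_def ring_mat_def)
  show ?thesis
  proof (rule ex_ex1I)
    have "?P *\<^sub>v (X *\<^sub>v (H *\<^sub>v b)) = (?P * X) *\<^sub>v (H *\<^sub>v b)"
      using P X H b by simp
    also have "\<dots> = Q *\<^sub>v (G *\<^sub>v (H *\<^sub>v b))"
      unfolding PXG using Q G H b by simp
    also have "G *\<^sub>v (H *\<^sub>v b) = b"
      using H b assoc_mult_mat_vec[OF G H(1) b] by simp
    finally have "?P *\<^sub>v (X *\<^sub>v (H *\<^sub>v b)) = Q *\<^sub>v b" .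
    moreover have "X *\<^sub>v (H *\<^sub>v b) \<in> range_mat X"
      unfolding range_mat_eq[OF X] using H b by auto
    ultimately show "\<exists>s. s \<in> range_mat X \<and> ?P *\<^sub>v s = Q *\<^sub>v b"
      by blast
  next
    fix s t
    assume s: "s \<in> range_mat X \<and> ?P *\<^sub>v s = Q *\<^sub>v b" and t: "t \<in> range_mat X \<and> ?P *\<^sub>v t = Q *\<^sub>v b"
    obtain c where c: "c \<in> carrier_vec k" "s = X *\<^sub>v c"
      using s unfolding range_mat_eq[OF X] by blast
    obtain d where d: "d \<in> carrier_vec k" "t = X *\<^sub>v d"
      using t unfolding range_mat_eq[OF X] by blast
    have "(?P * X) *\<^sub>v (c - d) = ?P *\<^sub>v s - ?P *\<^sub>v t"
      unfolding c(2) d(2) mult_minus_distrib_mat_vec[OF PX c(1) d(1)]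
      by (simp only: assoc_mult_mat_vec[OF P X c(1)] assoc_mult_mat_vec[OF P X d(1)])
    also have "\<dots> = 0\<^sub>v n"
      using s t Q b by simp
    finally have "c - d = 0\<^sub>v k"
      using inj c d by simp
    then have "(c - d) $ i = 0" if "i < k" for i
      using that by simp
    then have "c $ i = d $ i" if "i < k" for i
      using that c d by simp
    then have "c = d"
      using c d by (intro eq_vecI) auto
    then show "s = t"
      using c d by simp
  qed
qed

lemma mat_mult_unit_vec:
  fixes Q :: "'a :: semiring_1 mat"
  assumes "Q \<in> carrier_mat n k" "i < k"
  shows "Q *\<^sub>v unit_vec k i = col Q i"
  using assms by (intro eq_vecI) auto

definition leading_cols :: "nat \<Rightarrow> 'a mat \<Rightarrow> 'a mat" where
  "leading_cols k V = mat (dim_row V) k (\<lambda>(a, i). V $$ (a, i))"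

lemma leading_cols_carrier [simp]: "V \<in> carrier_mat n c \<Longrightarrow> leading_cols k V \<in> carrier_mat n k"
  by (simp add: leading_cols_def)

lemma col_leading_cols:
  assumes "k \<le> dim_col V" "i < k"
  shows "col (leading_cols k V) i = col V i"
  using assms by (intro eq_vecI) (auto simp: leading_cols_def)

lemma leading_cols_orthogonal:
  fixes V :: "real mat"
  assumes V: "V \<in> carrier_mat n n" and VV: "V\<^sup>T * V = 1\<^sub>m n" and k: "k \<le> n"
  shows "(leading_cols k V)\<^sup>T * leading_cols k V = 1\<^sub>m k"
proof (rule eq_matI)
  fix a b
  assume "a < dim_row (1\<^sub>m k :: real mat)" "b < dim_col (1\<^sub>m k :: real mat)"
  then have ab: "a < k" "b < k"
    by auto
  then have "(V\<^sup>T * V) $$ (a, b) = 1\<^sub>m n $$ (a, b)"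
    using VV by simp
  then show "((leading_cols k V)\<^sup>T * leading_cols k V) $$ (a, b) = 1\<^sub>m k $$ (a, b)"
    using ab k V carrier_matD[OF leading_cols_carrier[OF V, of k]] by (simp add: col_leading_cols)
qed (use V in \<open>auto simp: leading_cols_def\<close>)

lemma spectral_projector_eq:
  assumes V: "V \<in> carrier_mat n n" and k: "k \<le> n"
  shows "spectral_projector n V k = leading_cols k V * (leading_cols k V)\<^sup>T"
  using V k
  by (intro eq_matI)
    (auto simp: spectral_projector_def leading_cols_def scalar_prod_def atLeast0LessThan)

text \<open>Multiplying \<open>Q Q\<^sup>T w = 0\<close> by \<open>Q\<^sup>T\<close> from the left gives \<open>Q\<^sup>T w = 0\<close>.\<close>

lemma spectral_projector_kernel:
  assumes V: "V \<in> carrier_mat n n" and VV: "V\<^sup>T * V = 1\<^sub>m n" and k: "k \<le> n"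
    and w: "w \<in> carrier_vec n" and Pw: "spectral_projector n V k *\<^sub>v w = 0\<^sub>v n" and j: "j < k"
  shows "col V j \<bullet> w = 0"
proof -
  let ?Q = "leading_cols k V"
  have Q: "?Q \<in> carrier_mat n k" "?Q\<^sup>T \<in> carrier_mat k n"
    using V by auto
  have "?Q\<^sup>T *\<^sub>v w = (?Q\<^sup>T * ?Q) *\<^sub>v (?Q\<^sup>T *\<^sub>v w)"
    unfolding leading_cols_orthogonal[OF V VV k] using Q w by simp
  also have "\<dots> = ?Q\<^sup>T *\<^sub>v (spectral_projector n V k *\<^sub>v w)"
    unfolding spectral_projector_eq[OF V k]
    using assoc_mult_mat_vec[OF Q(2) Q(1), of "?Q\<^sup>T *\<^sub>v w"] assoc_mult_mat_vec[OF Q(1) Q(2) w] Q w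
    by simp
  also have "\<dots> = 0\<^sub>v k"
    unfolding Pw using Q(2) by (rule mult_mat_zero_vec)
  finally have "(?Q\<^sup>T *\<^sub>v w) $ j = 0"
    using j by simp
  then show ?thesis
    using j k V Q by (simp add: col_leading_cols)
qed

lemma smult_mult_mat_vec:
  fixes X :: "'a :: comm_semiring_1 mat"
  assumes "X \<in> carrier_mat a b" "x \<in> carrier_vec b"
  shows "(r \<cdot>\<^sub>m X) *\<^sub>v x = r \<cdot>\<^sub>v (X *\<^sub>v x)"
  using assms by (intro eq_vecI) (auto simp: scalar_prod_def sum_distrib_left ac_simps)

section \<open>The error bounds\<close>

text \<open>Both orthogonal factors preserve the norm, so only the diagonal matters, and only where the
  coordinates \<open>V\<^sup>T w\<close> can be nonzero. The cases \<open>Q = V\<close> and \<open>Q = U\<close> give the right and the left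
  error bound.\<close>

lemma norm2_filtered_le:
  assumes Q: "Q \<in> carrier_mat a n" and QQ: "Q\<^sup>T * Q = 1\<^sub>m n"
    and V: "V \<in> carrier_mat n n" and VV: "V\<^sup>T * V = 1\<^sub>m n"
    and w: "w \<in> carrier_vec n" and orth: "\<And>j. j < k \<Longrightarrow> col V j \<bullet> w = 0"
    and C: "C \<ge> 0" "\<And>j. k \<le> j \<Longrightarrow> j < n \<Longrightarrow> norm (d j) \<le> C"
  shows "norm2 ((complex_mat Q * mat_diag n d * (complex_mat V)\<^sup>T) *\<^sub>v complex_vec w) \<le> C * norm2 w"
proof -
  let ?W = "complex_mat V"
  let ?w = "complex_vec w"
  let ?c = "complex_vec (V\<^sup>T *\<^sub>v w)"
  have Vt: "V\<^sup>T \<in> carrier_mat n n" "V\<^sup>T\<^sup>T * V\<^sup>T = 1\<^sub>m n"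
    using V orthogonal_mat_right_inverse[OF V VV] by auto
  have c: "?c = ?W\<^sup>T *\<^sub>v ?w"
    using V w by (simp add: of_real_hom.mult_mat_vec_hom[OF Vt(1) w] map_mat_transpose)
  have cc: "?c \<in> carrier_vec n"
    using mult_mat_vec_carrier[OF Vt(1) w] by simp
  let ?x = "mat_diag n d *\<^sub>v ?c"
  have x: "?x \<in> carrier_vec n"
    using cc by (rule mult_mat_vec_carrier[OF mat_diag_dim])
  have xi: "?x $ j = d j * ?c $ j" if "j < n" for j
  proof -
    have "?x $ j = (\<Sum>i<n. (if i = j then d i else 0) * ?c $ i)"
      using that cc V by (simp add: mat_diag_def scalar_prod_def atLeast0LessThan)
        (intro sum.cong refl, auto)
    also have "\<dots> = (\<Sum>i<n. if i = j then d i * ?c $ i else 0)"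
      by (intro sum.cong) auto
    finally show ?thesis
      using that by simp
  qed
  have "(complex_mat Q * mat_diag n d * ?W\<^sup>T) *\<^sub>v ?w = complex_mat Q *\<^sub>v ?x"
  proof -
    have "(complex_mat Q * mat_diag n d * ?W\<^sup>T) *\<^sub>v ?w = (complex_mat Q * mat_diag n d) *\<^sub>v ?c"
      unfolding c using Q V w by (intro assoc_mult_mat_vec[of _ a n _ n]) auto
    also have "\<dots> = complex_mat Q *\<^sub>v ?x"
      using Q cc by (intro assoc_mult_mat_vec[of _ a n _ n]) auto
    finally show ?thesis .
  qed
  then have "norm2 ((complex_mat Q * mat_diag n d * ?W\<^sup>T) *\<^sub>v ?w) = norm2 ?x"
    using norm2_orthogonal_mat[OF Q QQ x] by simp
  also have "\<dots> \<le> C * norm2 ?c"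
  proof (rule norm2_mono)
    fix j
    assume "j < dim_vec ?c"
    then have j: "j < n"
      using V by simp
    show "norm (?x $ j) \<le> C * norm (?c $ j)"
    proof (cases "j < k")
      case True
      then have "?c $ j = 0"
        using j V orth by simp
      then show ?thesis
        unfolding xi[OF j] by simp
    next
      case False
      then show ?thesis
        unfolding xi[OF j] norm_mult using C j by (intro mult_right_mono) auto
    qed
  qed (use C V in \<open>auto simp: mat_diag_def\<close>)
  also have "norm2 ?c = norm2 w"
    using norm2_orthogonal_mat[OF Vt, of ?w] w
    by (simp add: of_real_hom.mult_mat_vec_hom[OF Vt(1) w] norm2_complex_vec)
  finally show ?thesis .
qed

lemma svd_mult_spectral_fun:
  assumes svd: "is_svd m n A U \<sigma> V"
  shows "complex_mat A * spectral_fun n V h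
    = complex_mat U * mat_diag n (\<lambda>i. complex_of_real (\<sigma> i) * h i) * (complex_mat V)\<^sup>T"
proof -
  have A: "A = U * mat_diag n \<sigma> * V\<^sup>T" and U: "U \<in> carrier_mat m n"
    and V: "V \<in> carrier_mat n n" and VV: "V\<^sup>T * V = 1\<^sub>m n"
    using svd by (auto simp: is_svd_def)
  have diag: "complex_mat (mat_diag n \<sigma>) = mat_diag n (\<lambda>i. complex_of_real (\<sigma> i))"
    by (rule eq_matI) (auto simp: mat_diag_def)
  have "complex_mat A = complex_mat U * mat_diag n (\<lambda>i. complex_of_real (\<sigma> i)) * (complex_mat V)\<^sup>T"
    unfolding A using U V
    by (simp add: of_real_hom.mat_hom_mult[of _ m n _ n] mult_carrier_mat[of _ m n _ n]
        diag map_mat_transpose)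
  then show ?thesis
    using mult_spectral_fun[of "complex_mat U" m n V "\<lambda>i. complex_of_real (\<sigma> i)" h] U V VV by simp
qed

lemma svd_mult_right_vector:
  assumes svd: "is_svd m n A U \<sigma> V" and i: "i < n"
  shows "A *\<^sub>v col V i = \<sigma> i \<cdot>\<^sub>v col U i"
proof -
  have A: "A = U * mat_diag n \<sigma> * V\<^sup>T" and Ac: "A \<in> carrier_mat m n" and U: "U \<in> carrier_mat m n"
    and V: "V \<in> carrier_mat n n" and VV: "V\<^sup>T * V = 1\<^sub>m n"
    using svd by (auto simp: is_svd_def)
  have "A * V = U * mat_diag n \<sigma> * (V\<^sup>T * V)"
    unfolding A using U V by (intro assoc_mult_mat[of _ m n _ n _ n]) auto
  also have "\<dots> = mat m n (\<lambda>(a, j). U $$ (a, j) * \<sigma> j)"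
    unfolding VV mat_diag_mult_right[OF U] by simp
  finally have "col (A * V) i = \<sigma> i \<cdot>\<^sub>v col U i"
    using i U by (intro eq_vecI) auto
  then show ?thesis
    using col_mult2[OF Ac V i] by simp
qed

text \<open>The iteration enters only through \<open>S = f(B)\<^sup>l K\<close>. Approximating \<open>v\<^sub>i\<close> by a filtered \<open>s\<close> leaves
  the filtered difference \<open>v\<^sub>i - s\<close>, which has no components along the first \<open>k\<close> columns of \<open>V\<close>,
  where the filter is large.\<close>

lemma filtered_krylov_error_bounds:
  fixes f :: "nat \<Rightarrow> complex" and K :: "real mat" and S P\<^sub>U P\<^sub>V :: "complex mat"
  assumes svd: "is_svd m n A U \<sigma> V" and K: "K \<in> carrier_mat n k" and kn: "k < n" and i: "i < k"
    and S: "S = spectral_fun n V (\<lambda>j. f j ^ l) * complex_mat K"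
    and PU: "is_orth_projector m P\<^sub>U (range_mat (complex_mat A * S))"
    and PV: "is_orth_projector n P\<^sub>V (range_mat S)"
    and f: "\<And>j. k \<le> j \<Longrightarrow> j < n \<Longrightarrow> norm (f j) \<le> norm (f k)" and fi: "f i \<noteq> 0"
    and s: "s \<in> range_mat K" and Ps: "spectral_projector n V k *\<^sub>v s = col V i"
  shows "norm2 ((1\<^sub>m n - P\<^sub>V) *\<^sub>v complex_vec (col V i)) \<le> norm2 (col V i - s) * norm (f k / f i) ^ l"
    and "\<sigma> i \<noteq> 0 \<Longrightarrow> norm2 ((1\<^sub>m m - P\<^sub>U) *\<^sub>v complex_vec (col U i))
      \<le> Max ((\<lambda>j. \<sigma> j / \<sigma> i) ` {k..<n}) * norm2 (col V i - s) * norm (f k / f i) ^ l"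
proof -
  have A: "A \<in> carrier_mat m n" and U: "U \<in> carrier_mat m n" and UU: "U\<^sup>T * U = 1\<^sub>m n"
    and V: "V \<in> carrier_mat n n" and VV: "V\<^sup>T * V = 1\<^sub>m n" and \<sigma>: "\<And>j. j < n \<Longrightarrow> \<sigma> j \<ge> 0"
    using svd by (auto simp: is_svd_def)
  have iN: "i < n"
    using i kn by simp
  let ?v = "complex_vec (col V i)" and ?u = "complex_vec (col U i)" and ?A = "complex_mat A"
  let ?P = "spectral_projector n V k"
  have P: "?P \<in> carrier_mat n n"
    by (simp add: spectral_projector_def)
  have v: "col V i \<in> carrier_vec n" "?v \<in> carrier_vec n"
    and u: "?u \<in> carrier_vec m"
    using V U by auto
  obtain c where c: "c \<in> carrier_vec k" "s = K *\<^sub>v c"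
    using s unfolding range_mat_eq[OF K] by blast
  have sc: "s \<in> carrier_vec n"
    using c K by simp
  define w where "w = col V i - s"
  have w: "w \<in> carrier_vec n"
    using v sc by (simp add: w_def)
  have "?P *\<^sub>v col V i = col V i"
  proof -
    let ?Q = "leading_cols k V"
    have Q: "?Q \<in> carrier_mat n k" "?Q\<^sup>T \<in> carrier_mat k n"
      using V by auto
    have "?P *\<^sub>v col V i = col (?Q * ?Q\<^sup>T * ?Q) i"
      using Q i V kn unfolding spectral_projector_eq[OF V less_imp_le[OF kn]]
      by (subst col_mult2[OF mult_carrier_mat[OF Q] Q(1) i]) (simp add: col_leading_cols)
    also have "?Q * ?Q\<^sup>T * ?Q = ?Q"
      using Q leading_cols_orthogonal[OF V VV, of k] kn by (simp add: assoc_mult_mat[OF Q Q(1)])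
    finally show ?thesis
      using i V kn by (simp add: col_leading_cols)
  qed
  then have Pw: "?P *\<^sub>v w = 0\<^sub>v n"
    unfolding w_def using v sc P Ps by (simp add: mult_minus_distrib_mat_vec[OF P])
  have orth: "col V j \<bullet> w = 0" if "j < k" for j
    by (rule spectral_projector_kernel[OF V VV less_imp_le[OF kn] w Pw that])
  \<comment> \<open>The filter, scaled to leave \<open>v\<^sub>i\<close> unchanged.\<close>
  define h where "h = (\<lambda>j. f j ^ l / f i ^ l)"
  let ?F = "spectral_fun n V h"
  have F: "?F \<in> carrier_mat n n"
    using V by simp
  have h_le: "norm (h j) \<le> norm (f k / f i) ^ l" if "k \<le> j" "j < n" for j
    using f[OF that] unfolding h_def
    by (simp add: norm_divide norm_power power_divide divide_right_mono power_mono)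
  define y where "y = ?F *\<^sub>v complex_vec s"
  have y: "y \<in> carrier_vec n"
    using F sc by (auto simp: y_def intro: mult_mat_vec_carrier)
  have Sc: "S \<in> carrier_mat n k"
    using V K by (auto simp: S intro!: mult_carrier_mat[of _ n n])
  let ?c = "(1 / f i ^ l) \<cdot>\<^sub>v complex_vec c"
  have cc: "?c \<in> carrier_vec k"
    using c by simp
  have Fh: "?F = (1 / f i ^ l) \<cdot>\<^sub>m spectral_fun n V (\<lambda>j. f j ^ l)"
    using V by (simp add: smult_spectral_fun h_def)
  have y_S: "y = S *\<^sub>v ?c"
  proof -
    let ?G = "spectral_fun n V (\<lambda>j. f j ^ l)"
    have G: "?G \<in> carrier_mat n n"
      using V by simp
    have "y = (1 / f i ^ l) \<cdot>\<^sub>v (?G *\<^sub>v (complex_mat K *\<^sub>v complex_vec c))"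
      unfolding y_def Fh c(2) using G K c
      by (simp add: of_real_hom.mult_mat_vec_hom[OF K c(1)] smult_mult_mat_vec[OF G])
    also have "\<dots> = (1 / f i ^ l) \<cdot>\<^sub>v (S *\<^sub>v complex_vec c)"
      unfolding S using G K c by (subst assoc_mult_mat_vec[of _ n n _ k]) auto
    finally show ?thesis
      using Sc c by (simp add: mult_mat_vec)
  qed
  have yr: "y \<in> range_mat S"
    unfolding range_mat_eq[OF Sc] y_S using cc by blast
  have "?F *\<^sub>v ?v = ?v"
    using spectral_fun_eigenvector[OF V VV iN, of h] fi v by (simp add: h_def)
  then have vy: "?v - y = ?F *\<^sub>v complex_vec w"
  proof -
    have "complex_vec w = ?v - complex_vec s"
      using V sc by (intro eq_vecI) (auto simp: w_def)
    then show ?thesis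
      using \<open>?F *\<^sub>v ?v = ?v\<close> F v sc unfolding y_def
      by (simp add: mult_minus_distrib_mat_vec[OF F])
  qed
  have bV: "norm2 (?F *\<^sub>v complex_vec w) \<le> norm (f k / f i) ^ l * norm2 w"
    unfolding spectral_fun_def
    by (rule norm2_filtered_le[OF V VV V VV w orth]) (use h_le in auto)
  show "norm2 ((1\<^sub>m n - P\<^sub>V) *\<^sub>v ?v) \<le> norm2 (col V i - s) * norm (f k / f i) ^ l"
    using orth_projector_best_approx[OF PV v(2) yr] bV
    by (simp add: vy w_def mult.commute)
  assume si: "\<sigma> i \<noteq> 0"
  define a where "a = Max ((\<lambda>j. \<sigma> j / \<sigma> i) ` {k..<n})"
  have a: "\<sigma> j / \<sigma> i \<le> a" if "k \<le> j" "j < n" for j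
    unfolding a_def using that by (intro Max_ge) auto
  \<comment> \<open>The maximum is over a nonempty set, since \<open>k < n\<close>, of nonnegative quotients.\<close>
  have a0: "a \<ge> 0"
    using a[of k] kn \<sigma>[of k] \<sigma>[OF iN] by (meson divide_nonneg_nonneg le_refl order_trans)
  have AS: "?A * S \<in> carrier_mat m k"
    using A Sc by auto
  \<comment> \<open>Dividing \<open>A y\<close> by \<open>\<sigma> i\<close> gives the approximation of \<open>u\<^sub>i\<close> in the range of \<open>A S\<close>.\<close>
  let ?s = "1 / complex_of_real (\<sigma> i)"
  let ?y = "?s \<cdot>\<^sub>v (?A *\<^sub>v y)"
  have Ac: "?A \<in> carrier_mat m n"
    using A by simp
  have "?y = (?A * S) *\<^sub>v (?s \<cdot>\<^sub>v ?c)"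
    unfolding y_S using cc
    by (simp only: mult_mat_vec[OF AS cc] assoc_mult_mat_vec[OF Ac Sc cc])
  then have yr': "?y \<in> range_mat (?A * S)"
    unfolding range_mat_eq[OF AS] using cc by auto
  let ?d = "\<lambda>j. complex_of_real (\<sigma> j) * (?s * h j)"
  have "?A *\<^sub>v ?v = complex_of_real (\<sigma> i) \<cdot>\<^sub>v ?u"
    unfolding of_real_hom.mult_mat_vec_hom[OF A v(1), symmetric] svd_mult_right_vector[OF svd iN]
    by (rule of_real_hom.vec_hom_smult)
  then have "?u = ?s \<cdot>\<^sub>v (?A *\<^sub>v ?v)"
    using si u by (intro eq_vecI) (auto simp: smult_smult_assoc)
  then have "?u - ?y = ?s \<cdot>\<^sub>v (?A *\<^sub>v (?v - y))"
    unfolding mult_minus_distrib_mat_vec[OF Ac v(2) y]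
    using Ac v y by (intro eq_vecI) (auto simp: algebra_simps)
  also have "\<dots> = ?A *\<^sub>v (spectral_fun n V (\<lambda>j. ?s * h j) *\<^sub>v complex_vec w)"
    unfolding vy smult_spectral_fun[OF V, symmetric]
    using F w Ac by (simp add: smult_mult_mat_vec[OF F] mult_mat_vec[OF Ac, of "?F *\<^sub>v complex_vec w"])
  also have "\<dots> = (complex_mat U * mat_diag n ?d * (complex_mat V)\<^sup>T) *\<^sub>v complex_vec w"
    unfolding svd_mult_spectral_fun[OF svd, symmetric]
    using Ac V w by (intro assoc_mult_mat_vec[symmetric, of _ m n _ n]) auto
  finally have uy: "?u - ?y = \<dots>" .
  have d: "norm (?d j) \<le> a * norm (f k / f i) ^ l" if "k \<le> j" "j < n" for j
  proof -
    have "norm (?d j) = \<sigma> j / \<sigma> i * norm (h j)"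
      using \<sigma>[OF that(2)] \<sigma>[OF iN] by (simp add: norm_mult norm_divide)
    also have "\<dots> \<le> a * norm (f k / f i) ^ l"
      using a[OF that] h_le[OF that] a0 by (intro mult_mono) auto
    finally show ?thesis .
  qed
  have "norm2 (?u - ?y) \<le> a * norm (f k / f i) ^ l * norm2 w"
    unfolding uy
    by (rule norm2_filtered_le[OF U UU V VV w orth]) (use d a0 in auto)
  then have "norm2 ((1\<^sub>m m - P\<^sub>U) *\<^sub>v ?u) \<le> a * norm (f k / f i) ^ l * norm2 w"
    using orth_projector_best_approx[OF PU u yr'] by (rule order_trans[rotated])
  also have "\<dots> = a * norm2 w * norm (f k / f i) ^ l"
    by (simp only: mult.assoc mult.commute[of "norm2 w"])
  finally show "norm2 ((1\<^sub>m m - P\<^sub>U) *\<^sub>v ?u)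
      \<le> Max ((\<lambda>j. \<sigma> j / \<sigma> i) ` {k..<n}) * norm2 (col V i - s) * norm (f k / f i) ^ l"
    unfolding a_def w_def .
qed

theorem theorem3:
  fixes m n L M N l :: nat
    and A U V Vin K P\<^sub>L\<^sub>M :: "real mat"
    and \<sigma> :: "nat \<Rightarrow> real"
    and z \<omega> :: "nat \<Rightarrow> complex"
    and f :: "real \<Rightarrow> complex"
    and S P\<^sub>U P\<^sub>V :: "complex mat"
  assumes "m \<ge> n"
    and svd: "is_svd m n A U \<sigma> V"
    and "L \<ge> 1" "M \<ge> 1" "N \<ge> 1" "l \<ge> 1" "M \<le> N" "L * M < n"
    and "Vin \<in> carrier_mat n L"
    and "\<forall>j<N. z j \<noteq> 0 \<and> \<not> eigenvalue (complex_mat (A\<^sup>T * A)) (z j)"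
    and "\<forall>k. k + 2 \<le> N \<longrightarrow> (\<Sum>j<N. \<omega> j * z j ^ k) = 0"
    and "(\<Sum>j<N. \<omega> j * inverse (z j)) \<noteq> 0"
    and f: "f = filter_fun N z \<omega>"
    and "\<forall>i. i + 1 < n \<longrightarrow> norm (f (\<sigma> i)) \<ge> norm (f (\<sigma> (i + 1)))"
    and S: "S = S_hat n L M A N z \<omega> Vin l"
    and K: "K = krylov_mat n L M A Vin"
    and "is_orth_projector m P\<^sub>U (range_mat (complex_mat A * S))"
    and "is_orth_projector n P\<^sub>V (range_mat S)"
    and P\<^sub>L\<^sub>M: "P\<^sub>L\<^sub>M = spectral_projector n V (L * M)"
    and "rank_mat (P\<^sub>L\<^sub>M * K) = L * M"
  shows "\<forall>i<L * M.
     (\<exists>!s. s \<in> range_mat K \<and> P\<^sub>L\<^sub>M *\<^sub>v s = col V i) \<and>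
     (\<forall>s. s \<in> range_mat K \<and> P\<^sub>L\<^sub>M *\<^sub>v s = col V i \<longrightarrow>
        (let \<alpha> = Max ((\<lambda>j. \<sigma> j / \<sigma> i) ` {L * M..<n});
             \<beta> = norm2 (col V i - s);
             u = complex_vec (col U i);
             v = complex_vec (col V i)
         in (f (\<sigma> i) \<noteq> 0 \<and> \<sigma> i \<noteq> 0 \<longrightarrow>
               norm2 ((1\<^sub>m m - P\<^sub>U) *\<^sub>v u) \<le> \<alpha> * \<beta> * norm (f (\<sigma> (L * M)) / f (\<sigma> i)) ^ l) \<and>
            (f (\<sigma> i) \<noteq> 0 \<longrightarrow>
               norm2 ((1\<^sub>m n - P\<^sub>V) *\<^sub>v v) \<le> \<beta> * norm (f (\<sigma> (L * M)) / f (\<sigma> i)) ^ l)))"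
proof (intro allI impI)
  fix i
  assume i: "i < L * M"
  have V: "V \<in> carrier_mat n n" and VV: "V\<^sup>T * V = 1\<^sub>m n" and A: "A \<in> carrier_mat m n"
    using svd by (auto simp: is_svd_def)
  have k: "L * M \<le> n"
    using \<open>L * M < n\<close> by simp
  have Kc: "K \<in> carrier_mat n (L * M)"
    by (simp add: K krylov_mat_def)
  let ?Q = "leading_cols (L * M) V"
  have Q: "?Q \<in> carrier_mat n (L * M)"
    using V by simp
  have P: "P\<^sub>L\<^sub>M = ?Q * ?Q\<^sup>T"
    unfolding P\<^sub>L\<^sub>M by (rule spectral_projector_eq[OF V k])
  have "vec_space.rank n (?Q * ?Q\<^sup>T * K) = L * M"
    using \<open>rank_mat (P\<^sub>L\<^sub>M * K) = L * M\<close> Q by (simp add: P leading_cols_def V carrier_matD[OF V])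
  then have "\<exists>!s. s \<in> range_mat K \<and> P\<^sub>L\<^sub>M *\<^sub>v s = ?Q *\<^sub>v unit_vec (L * M) i"
    unfolding P
    by (intro ex1_range_projecting_to[OF Q leading_cols_orthogonal[OF V VV k] Kc]) auto
  moreover have "?Q *\<^sub>v unit_vec (L * M) i = col V i"
    using mat_mult_unit_vec[OF Q i] col_leading_cols[of "L * M" V i] V i k by simp
  ultimately have ex1: "\<exists>!s. s \<in> range_mat K \<and> P\<^sub>L\<^sub>M *\<^sub>v s = col V i"
    by simp
  have S_eq: "S = spectral_fun n V (\<lambda>j. f (\<sigma> j) ^ l) * complex_mat K"
    unfolding S K f using assms by (intro S_hat_filtered_krylov[OF svd]) auto
  have dec: "norm (f (\<sigma> j)) \<le> norm (f (\<sigma> (L * M)))" if "L * M \<le> j" "j < n" for j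
    using that
  proof (induction j rule: dec_induct)
    case (step j)
    then show ?case
      using \<open>\<forall>i. i + 1 < n \<longrightarrow> norm (f (\<sigma> i)) \<ge> norm (f (\<sigma> (i + 1)))\<close>
      by (metis Suc_eq_plus1 Suc_lessD order_trans)
  qed simp
  show "(\<exists>!s. s \<in> range_mat K \<and> P\<^sub>L\<^sub>M *\<^sub>v s = col V i) \<and>
     (\<forall>s. s \<in> range_mat K \<and> P\<^sub>L\<^sub>M *\<^sub>v s = col V i \<longrightarrow>
        (let \<alpha> = Max ((\<lambda>j. \<sigma> j / \<sigma> i) ` {L * M..<n});
             \<beta> = norm2 (col V i - s);
             u = complex_vec (col U i);
             v = complex_vec (col V i)
         in (f (\<sigma> i) \<noteq> 0 \<and> \<sigma> i \<noteq> 0 \<longrightarrow>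
               norm2 ((1\<^sub>m m - P\<^sub>U) *\<^sub>v u) \<le> \<alpha> * \<beta> * norm (f (\<sigma> (L * M)) / f (\<sigma> i)) ^ l) \<and>
            (f (\<sigma> i) \<noteq> 0 \<longrightarrow>
               norm2 ((1\<^sub>m n - P\<^sub>V) *\<^sub>v v) \<le> \<beta> * norm (f (\<sigma> (L * M)) / f (\<sigma> i)) ^ l)))"
    unfolding Let_def
    using ex1 filtered_krylov_error_bounds[where f = "\<lambda>j. f (\<sigma> j)",
        OF svd Kc \<open>L * M < n\<close> i S_eq \<open>is_orth_projector m P\<^sub>U _\<close> \<open>is_orth_projector n P\<^sub>V _\<close> dec]
    unfolding P\<^sub>L\<^sub>M by blast
qed

end
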